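(* For a fixed $k \geq 0$, let $\mathcal{L}_n^k$ be the collection of all planar $n$-point configurations in which $n-k$ of the points (including the point off the line) form a projected polygon configuration, with line $\ell$, and the remaining $k$ points are placed arbitrarily on the line $\ell$. Then $$\max_{\mathcal{P} \in \mathcal{L}_n^k} A(\mathcal{P}) = \Theta(nk).$$
   Context: For a finite set $\mathcal P \subset \mathbb{R}^2$, $A(\mathcal P)$ denotes the number of distinct angles in the open interval $(0,\pi)$ determined by triples of distinct points of $\mathcal P$ (angles of $0$ and $\pi$ are not counted). Projected polygon configuration on $m$ points: take the vertices of a regular $m$-gon and fix a vertex $p$. If $m$ is even, let $q$ be the vertex opposite $p$ and let $\ell$ be a line perpendicular to $\overline{pq}$ not passing through $p$ (all such choices give similar configurations). If $m$ is odd, let $\ell$ be the line through the two vertices at minimal distance from $p$. Project each vertex $r \ne p$ to the intersection point of the line $pr$ with $\ell$. The configuration consists of $p$ (the point off the line) together with the $m-1$ projected points on $\ell$. $f = O(g)$ means there is a constant $C$ with $f(n) \le C g(n)$ for all sufficiently large $n$; $f=\Omega(g)$ means $g = O(f)$; $f=\Theta(g)$ means both $f=O(g)$ and $f=\Omega(g)$.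
   Formalization: The bound Θ(nk) is proved for k ≥ 1 (also with constants independent of k); for k = 0 it would read Θ(0), which is false because the projected polygon configuration already has at least n−2 angles, so for k = 0 the correct order Θ(n) is proved instead. *)

theory Defs
  imports "HOL-Analysis.Analysis" "HOL-Library.Landau_Symbols"
begin

definition angle_at :: "real^2 \<Rightarrow> real^2 \<Rightarrow> real^2 \<Rightarrow> real" where
  "angle_at a b c = arccos (((a - b) \<bullet> (c - b)) / (norm (a - b) * norm (c - b)))"

definition angle_set :: "(real^2) set \<Rightarrow> real set" where
  "angle_set P =
     {angle_at a b c | a b c. a \<in> P \<and> b \<in> P \<and> c \<in> P \<and> a \<noteq> b \<and> b \<noteq> c \<and> a \<noteq> c} \<inter> {0<..<pi}"

definition num_angles :: "(real^2) set \<Rightarrow> nat" where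
  "num_angles P = card (angle_set P)"

definition regular_polygon :: "nat \<Rightarrow> real^2 \<Rightarrow> (real^2) set \<Rightarrow> bool" where
  "regular_polygon m z V \<longleftrightarrow> 3 \<le> m \<and>
     (\<exists>r>0. \<exists>\<theta>. V = (\<lambda>j. z + r *\<^sub>R vector [cos (\<theta> + 2 * pi * real j / real m),
                                             sin (\<theta> + 2 * pi * real j / real m)]) ` {..<m})"

definition is_line :: "(real^2) set \<Rightarrow> bool" where
  "is_line l \<longleftrightarrow> affine l \<and> aff_dim l = 1"

text \<open>The line onto which the polygon is projected from its vertex \<open>p\<close>. For even \<open>m\<close> the vertex \<open>q\<close>
  opposite to \<open>p\<close> is its mirror image in the centre \<open>z\<close>.\<close>

definition projection_line ::
    "nat \<Rightarrow> real^2 \<Rightarrow> (real^2) set \<Rightarrow> real^2 \<Rightarrow> (real^2) set \<Rightarrow> bool" where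
  "projection_line m z V p l \<longleftrightarrow>
     (if even m
      then is_line l \<and> p \<notin> l \<and>
           (\<exists>q\<in>V. midpoint p q = z \<and> (\<forall>x\<in>l. \<forall>y\<in>l. orthogonal (x - y) (q - p)))
      else (\<exists>u\<in>V - {p}. \<exists>v\<in>V - {p}. u \<noteq> v \<and>
              (\<forall>w\<in>V - {p}. dist p u \<le> dist p w \<and> dist p v \<le> dist p w) \<and>
              l = affine hull {u, v}))"

definition projected_polygon_config ::
    "nat \<Rightarrow> (real^2) set \<Rightarrow> (real^2) set \<Rightarrow> bool" where
  "projected_polygon_config m l Q \<longleftrightarrow>
     (\<exists>z V p. regular_polygon m z V \<and> p \<in> V \<and> projection_line m z V p l \<and>
        Q = insert p (\<Union>r\<in>V - {p}. affine hull {p, r} \<inter> l))"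

definition configs :: "nat \<Rightarrow> nat \<Rightarrow> (real^2) set set" where
  "configs n k =
     {P. finite P \<and> card P = n \<and>
        (\<exists>l Q S. projected_polygon_config (n - k) l Q \<and> card Q = n - k \<and>
           S \<subseteq> l \<and> card S = k \<and> Q \<inter> S = {} \<and> P = Q \<union> S)}"

text \<open>The maximum ranges over infinitely many configurations but finitely many values; see
  \<open>finite_num_angles_configs\<close>.\<close>

definition max_angles :: "nat \<Rightarrow> nat \<Rightarrow> nat" where
  "max_angles n k = Max (num_angles ` configs n k)"

lemma num_angles_le:
  assumes "finite P"
  shows "num_angles P \<le> card P ^ 3"
proof -
  have sub: "angle_set P \<subseteq> (\<lambda>(a, b, c). angle_at a b c) ` (P \<times> P \<times> P)"
    by (force simp: angle_set_def)
  have "num_angles P \<le> card (P \<times> P \<times> P)"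
    unfolding num_angles_def using surj_card_le[OF _ sub] assms by auto
  also have "\<dots> = card P ^ 3"
    by (simp add: card_cartesian_product power3_eq_cube)
  finally show ?thesis .
qed

lemma finite_num_angles_configs: "finite (num_angles ` configs n k)"
proof (rule finite_subset)
  show "num_angles ` configs n k \<subseteq> {..n ^ 3}"
    using num_angles_le by (auto simp: configs_def)
qed simp

end

theory Submission imports Defs begin

text \<open>A point of \<open>\<ell>\<close> is the vertex of at most two angles, since all rays from it run along \<open>\<ell>\<close> or
  through \<open>p\<close>. At \<open>p\<close>, two projected points span a multiple of \<open>\<pi> / m\<close> by the inscribed angle
  theorem, and each of the \<open>k\<close> extra points contributes at most \<open>n\<close> further angles, so there are
  \<open>O(n + nk)\<close> in total. Conversely, extra points whose directions from \<open>p\<close> are distinct and lie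
  strictly between \<open>0\<close> and \<open>\<pi> / m\<close> form pairwise distinct angles with the projected vertices.\<close>

section \<open>Angles as functions of unit directions\<close>

lemma angle_at_sgn: "angle_at a b c = arccos (sgn (a - b) \<bullet> sgn (c - b))"
  by (simp add: angle_at_def sgn_div_norm divide_inverse mult_ac)

lemma angle_at_commute: "angle_at a b c = angle_at c b a"
  by (simp add: angle_at_sgn inner_commute)

lemma abs_inner_sgn_le: "\<bar>sgn x \<bullet> sgn y\<bar> \<le> (1::real)" for x y :: "'a::real_inner"
  using Cauchy_Schwarz_ineq2[of "sgn x" "sgn y"] by (auto simp: norm_sgn split: if_splits)

text \<open>Reversing one ray changes the sign of the cosine and so replaces the angle by its
  supplement. Hence the lines spanned by \<open>u\<close> and \<open>v\<close> fix the angle up to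
  supplement.\<close>

lemma angle_at_scaled:
  assumes "a - b = s *\<^sub>R u" "c - b = t *\<^sub>R v" "s \<noteq> 0" "t \<noteq> 0"
  shows "angle_at a b c \<in> {arccos (sgn u \<bullet> sgn v), pi - arccos (sgn u \<bullet> sgn v)}"
proof -
  have "angle_at a b c = arccos ((sgn s * sgn t) * (sgn u \<bullet> sgn v))"
    by (simp add: angle_at_sgn assms sgn_scaleR mult_ac)
  moreover have "sgn s * sgn t = 1 \<or> sgn s * sgn t = -1"
    using assms(3,4) by (auto simp: sgn_real_def)
  moreover have "arccos (- (sgn u \<bullet> sgn v)) = pi - arccos (sgn u \<bullet> sgn v)"
    using abs_inner_sgn_le[of u v] by (intro arccos_minus) auto
  ultimately show ?thesis by auto
qed

text \<open>Since \<open>card\<close> is 0 on infinite sets, finiteness is what lets an injection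
  into \<open>angle_set P\<close> bound \<open>num_angles P\<close> from below.\<close>

lemma finite_angle_set:
  assumes "finite P"
  shows "finite (angle_set P)"
proof -
  have "angle_set P \<subseteq> (\<lambda>(a, b, c). angle_at a b c) ` (P \<times> P \<times> P)"
    by (force simp: angle_set_def)
  then show ?thesis
    by (rule finite_subset) (use assms in auto)
qed

section \<open>Upper bound\<close>

text \<open>Two rays from \<open>b\<close> along \<open>l\<close> enclose 0 or \<pi>, which are not
  counted. A counted angle therefore has one side through \<open>p\<close> and the other along the
  direction of \<open>l\<close>, and only the sense of the latter can vary.\<close>

lemma angles_at_collinear_point:
  assumes "collinear l" "b \<in> l"
  obtains \<alpha> where "\<And>a c. \<lbrakk>a \<in> insert p l; c \<in> insert p l; a \<noteq> b; c \<noteq> b; a \<noteq> c;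
    angle_at a b c \<in> {0<..<pi}\<rbrakk> \<Longrightarrow> angle_at a b c \<in> {\<alpha>, pi - \<alpha>}"
proof -
  obtain u where u: "\<And>x y. x \<in> l \<Longrightarrow> y \<in> l \<Longrightarrow> \<exists>t. x - y = t *\<^sub>R u"
    using assms(1) by (auto simp: collinear_def)
  have ray: "\<exists>t. x - b = t *\<^sub>R u \<and> t \<noteq> 0" if "x \<in> l" "x \<noteq> b" for x
    using u[OF that(1) assms(2)] that(2) by auto
  define \<alpha> where "\<alpha> = arccos (sgn (p - b) \<bullet> sgn u)"
  have with_p: "angle_at p b x \<in> {\<alpha>, pi - \<alpha>}" if "x \<in> l" "x \<noteq> b" for x
    using ray[OF that] angle_at_scaled[of p b 1 "p - b" x _ u] by (auto simp: \<alpha>_def)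
  have on_line: "angle_at x b y \<notin> {0<..<pi}" if xy: "x \<in> l" "y \<in> l" "x \<noteq> b" "y \<noteq> b" for x y
  proof -
    obtain s t where st: "x - b = s *\<^sub>R u" "y - b = t *\<^sub>R u" "s \<noteq> 0" "t \<noteq> 0"
      using ray[OF xy(1,3)] ray[OF xy(2,4)] by blast
    \<comment> \<open>As \<open>sgn 0 = 0\<close>, a zero \<open>u\<close> would give the value
      \<pi>/2 instead of 0 or \<pi>.\<close>
    then have "u \<noteq> 0" using xy by auto
    then have "sgn u \<bullet> sgn u = 1" by (simp add: dot_square_norm norm_sgn)
    then show ?thesis using angle_at_scaled[OF st] by auto
  qed
  show ?thesis
  proof (rule that)
    fix a c assume "a \<in> insert p l" "c \<in> insert p l" "a \<noteq> b" "c \<noteq> b" "a \<noteq> c"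
      "angle_at a b c \<in> {0<..<pi}"
    then show "angle_at a b c \<in> {\<alpha>, pi - \<alpha>}"
      using with_p on_line angle_at_commute[of a b c] by (metis insertE)
  qed
qed

section \<open>Inscribed angles in a regular polygon\<close>

text \<open>A chord is perpendicular to the radius that bisects its arc, so its direction depends
  only on the sum \<open>x + y\<close>. This is the source of the inscribed angle theorem
  below.\<close>

lemma circle_chord:
  "(vector [cos x, sin x] :: real^2) - vector [cos y, sin y] =
     (2 * sin ((x - y) / 2)) *\<^sub>R vector [- sin ((x + y) / 2), cos ((x + y) / 2)]"
proof -
  have "sin ((y - x) / 2) = - sin ((x - y) / 2)"
    by (metis minus_diff_eq minus_divide_left sin_minus)
  then show ?thesis
    by (simp add: vec_eq_iff forall_2 cos_diff_cos sin_diff_sin)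
qed

lemma norm_cos_sin: "norm (vector [cos x, sin x] :: real^2) = 1"
  by (simp add: norm_eq_1 inner_vec_def sum_2 power2_eq_square[symmetric])

lemma norm_sin_cos: "norm (vector [- sin x, cos x] :: real^2) = 1"
  by (simp add: norm_eq_1 inner_vec_def sum_2 power2_eq_square[symmetric])

lemma arccos_cos_multiple:
  assumes "0 < m"
  obtains e where "e \<le> m" "arccos (cos (pi * real_of_int d / real m)) = pi * real e / real m"
proof -
  \<comment> \<open>A full turn is \<open>2 * m\<close> steps of \<pi>/m; a remainder beyond
    \<open>m\<close> is then reflected by cos (2\<pi> - x) = cos x into the range of
    \<open>arccos\<close>.\<close>
  define r where "r = d mod (2 * int m)"
  have r: "0 \<le> r" "r < 2 * int m" using assms by (auto simp: r_def)
  define q where "q = d div (2 * int m)"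
  have "d = r + 2 * int m * q" by (simp add: r_def q_def)
  then have "pi * real_of_int d / real m = pi * real_of_int r / real m + 2 * pi * real_of_int q"
    using assms by (simp add: field_simps)
  then have c: "cos (pi * real_of_int d / real m) = cos (pi * real_of_int r / real m)"
    by (simp add: cos_add)
  show ?thesis
  proof (cases "r \<le> int m")
    case True
    have "pi * real_of_int r / real m \<le> pi" using True assms by (simp add: field_simps)
    then have "arccos (cos (pi * real_of_int r / real m)) = pi * real_of_int r / real m"
      using r by (intro arccos_cos) auto
    then show ?thesis using that[of "nat r"] True r c by simp
  next
    case False
    define e where "e = nat (2 * int m - r)"
    have e: "real e = 2 * real m - real_of_int r" "e \<le> m" using r False by (auto simp: e_def)
    then have "pi * real e / real m = 2 * pi - pi * real_of_int r / real m"
      unfolding e(1) using assms by (simp add: field_simps)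
    then have "cos (pi * real_of_int r / real m) = cos (pi * real e / real m)"
      by (simp add: cos_2pi_minus)
    moreover have "pi * real e / real m \<le> pi" using e(2) assms by (simp add: field_simps)
    then have "arccos (cos (pi * real e / real m)) = pi * real e / real m"
      by (intro arccos_cos) auto
    ultimately show ?thesis using that[OF e(2)] c by simp
  qed
qed

text \<open>By the chord formula, the line from vertex \<open>i0\<close> to vertex \<open>j\<close>
  has direction index \<open>j + i0\<close> in steps of \<pi>/m, so two such lines differ by a
  multiple of \<pi>/m. Stating this for points of the lines covers projections on either side of
  \<open>p\<close>.\<close>

lemma angle_at_polygon_vertex:
  assumes V: "regular_polygon m z V" and "p \<in> V" "r \<in> V - {p}" "s \<in> V - {p}"
    and "a \<in> affine hull {p, r}" "b \<in> affine hull {p, s}" "a \<noteq> p" "b \<noteq> p"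
  shows "angle_at a p b \<in> (\<lambda>e. pi * real e / real m) ` {..m}"
proof -
  obtain R \<theta> where m: "0 < m"
    and Veq: "V = (\<lambda>j. z + R *\<^sub>R vector [cos (\<theta> + 2 * pi * real j / real m),
                                sin (\<theta> + 2 * pi * real j / real m)]) ` {..<m}"
    using V by (auto simp: regular_polygon_def)
  define w :: "nat \<Rightarrow> real^2" where
    "w = (\<lambda>i. vector [- sin (\<theta> + pi * real i / real m), cos (\<theta> + pi * real i / real m)])"
  obtain i0 where i0: "p = z + R *\<^sub>R vector [cos (\<theta> + 2 * pi * real i0 / real m),
      sin (\<theta> + 2 * pi * real i0 / real m)]"
    using assms(2) Veq by auto
  have dir: "\<exists>t i. x - p = t *\<^sub>R w i \<and> t \<noteq> 0"
    if vr: "v \<in> V - {p}" "x \<in> affine hull {p, v}" "x \<noteq> p" for v x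
  proof -
    obtain j where j: "v = z + R *\<^sub>R vector [cos (\<theta> + 2 * pi * real j / real m),
        sin (\<theta> + 2 * pi * real j / real m)]"
      using vr Veq by auto
    have mid: "(\<theta> + 2 * pi * real j / real m + (\<theta> + 2 * pi * real i0 / real m)) / 2
        = \<theta> + pi * real (j + i0) / real m"
      using m by (simp add: field_simps)
    have "\<exists>q. v - p = q *\<^sub>R w (j + i0)"
      unfolding w_def i0 j mid[symmetric]
      by (simp add: circle_chord flip: scaleR_diff_right)
    then obtain q where q: "v - p = q *\<^sub>R w (j + i0)" by blast
    obtain t where "x = p + t *\<^sub>R (v - p)"
      using vr(2) by (auto simp: affine_hull_2_alt)
    then have "x - p = (t * q) *\<^sub>R w (j + i0)" using q by simp
    moreover from this have "t * q \<noteq> 0" using vr(3) by auto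
    ultimately show ?thesis by blast
  qed
  obtain t i where ti: "a - p = t *\<^sub>R w i" "t \<noteq> 0" using dir assms by blast
  obtain t' i' where ti': "b - p = t' *\<^sub>R w i'" "t' \<noteq> 0" using dir assms by blast
  have sgn_w: "sgn (w x) = w x" for x by (simp add: sgn_div_norm w_def norm_sin_cos)
  have "w i \<bullet> w i' = cos ((\<theta> + pi * real i / real m) - (\<theta> + pi * real i' / real m))"
    unfolding cos_diff by (simp add: w_def inner_vec_def sum_2)
  also have "(\<theta> + pi * real i / real m) - (\<theta> + pi * real i' / real m)
      = pi * real_of_int (int i - int i') / real m"
    by (simp add: algebra_simps diff_divide_distrib)
  finally have cw: "w i \<bullet> w i' = cos (pi * real_of_int (int i - int i') / real m)" .
  obtain e where e: "e \<le> m" "arccos (w i \<bullet> w i') = pi * real e / real m"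
    using arccos_cos_multiple[OF m] cw by metis
  \<comment> \<open>The set of multiples is closed under supplements, so the orientation of the two
    rays does not matter.\<close>
  have "pi - pi * real e / real m = pi * real (m - e) / real m"
    using e(1) m by (simp add: of_nat_diff field_simps)
  moreover have "angle_at a p b \<in> {arccos (w i \<bullet> w i'), pi - arccos (w i \<bullet> w i')}"
    using angle_at_scaled[OF ti(1) ti'(1) ti(2) ti'(2)] by (simp add: sgn_w)
  ultimately have "angle_at a p b = pi * real e / real m \<or> angle_at a p b = pi * real (m - e) / real m"
    using e(2) by auto
  moreover have "e \<in> {..m}" "m - e \<in> {..m}" using e(1) by auto
  ultimately show ?thesis by blast
qed

section \<open>Counting the angles of a configuration\<close>

lemma collinear_projection_line:
  assumes "projection_line m z V p l"
  shows "collinear l"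
  using assms
  by (auto simp: projection_line_def is_line_def collinear_aff_dim
      collinear_affine_hull_collinear split: if_splits)

text \<open>The angles split by vertex: \<open>X\<close> holds at most two for each vertex on
  \<open>l\<close>, \<open>Y\<close> the multiples of \<pi>/m at \<open>p\<close>, and
  \<open>Z\<close> the angles at \<open>p\<close> with a side through an extra point.\<close>

lemma num_angles_config_le:
  assumes "P \<in> configs n k"
  shows "num_angles P \<le> 4 * n + k * n"
proof -
  obtain l Q S where P: "finite P" "card P = n" "projected_polygon_config (n - k) l Q"
      "S \<subseteq> l" "card S = k" "Q \<inter> S = {}" "P = Q \<union> S"
    using assms by (auto simp: configs_def)
  define m where "m = n - k"
  obtain z V p where V: "regular_polygon m z V" "p \<in> V" "projection_line m z V p l"
      "Q = insert p (\<Union>r\<in>V - {p}. affine hull {p, r} \<inter> l)"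
    using P(3) by (auto simp: projected_polygon_config_def m_def)
  have m: "3 \<le> m" using V(1) by (simp add: regular_polygon_def)
  have col: "collinear l" using collinear_projection_line[OF V(3)] .
  define L where "L = P - {p}"
  have L: "L \<subseteq> l" "finite L" "card L \<le> n"
    using P V(4) by (auto simp: L_def card_Diff_subset intro: card_mono)
  have "\<forall>b\<in>l. \<exists>\<alpha>. \<forall>a c. a \<in> insert p l \<longrightarrow> c \<in> insert p l \<longrightarrow> a \<noteq> b \<longrightarrow> c \<noteq> b \<longrightarrow> a \<noteq> c \<longrightarrow>
      angle_at a b c \<in> {0<..<pi} \<longrightarrow> angle_at a b c \<in> {\<alpha>, pi - \<alpha>}"
    (is "\<forall>b\<in>l. \<exists>\<alpha>. ?two b \<alpha>")
  proof
    fix b assume "b \<in> l"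
    show "\<exists>\<alpha>. ?two b \<alpha>"
      by (rule angles_at_collinear_point[OF col \<open>b \<in> l\<close>, of p]) blast
  qed
  from bchoice[OF this] obtain \<alpha> where \<alpha>: "\<And>a b c. \<lbrakk>b \<in> l; a \<in> insert p l; c \<in> insert p l; a \<noteq> b; c \<noteq> b; a \<noteq> c;
      angle_at a b c \<in> {0<..<pi}\<rbrakk> \<Longrightarrow> angle_at a b c \<in> {\<alpha> b, pi - \<alpha> b}"
    by blast
  define X where "X = \<alpha> ` L \<union> (\<lambda>b. pi - \<alpha> b) ` L"
  define Y where "Y = (\<lambda>e. pi * real e / real m) ` {..m}"
  define Z where "Z = (\<lambda>(s, x). angle_at s p x) ` (S \<times> L)"
  have "angle_set P \<subseteq> X \<union> Y \<union> Z"
  proof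
    fix y assume "y \<in> angle_set P"
    then obtain a b c where abc: "y = angle_at a b c" "a \<in> P" "b \<in> P" "c \<in> P"
        "a \<noteq> b" "c \<noteq> b" "a \<noteq> c" "y \<in> {0<..<pi}"
      by (auto simp: angle_set_def)
    show "y \<in> X \<union> Y \<union> Z"
    proof (cases "b = p")
      case False
      then have "b \<in> L" using abc by (simp add: L_def)
      moreover have "a \<in> insert p l" "c \<in> insert p l" using L abc by (auto simp: L_def)
      ultimately show ?thesis using \<alpha>[of b a c] L(1) abc by (auto simp: X_def)
    next
      case True
      then have L': "a \<in> L" "c \<in> L" using abc by (auto simp: L_def)
      consider "a \<in> S" | "c \<in> S" | "a \<in> Q" "c \<in> Q" using abc P by auto
      then show ?thesis
      proof cases
        case 1
        then show ?thesis using L' abc True by (auto simp: Z_def)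
      next
        case 2
        then show ?thesis using L' abc True angle_at_commute[of a b c] by (auto simp: Z_def)
      next
        case 3
        then obtain r s where "r \<in> V - {p}" "s \<in> V - {p}"
            "a \<in> affine hull {p, r}" "c \<in> affine hull {p, s}"
          using V(4) True abc by blast
        then show ?thesis
          using angle_at_polygon_vertex[OF V(1,2)] abc True unfolding Y_def by blast
      qed
    qed
  qed
  moreover have "finite S" using P by auto
  then have "finite (X \<union> Y \<union> Z)" using L by (auto simp: X_def Y_def Z_def)
  ultimately have "num_angles P \<le> card (X \<union> Y \<union> Z)"
    unfolding num_angles_def by (intro card_mono)
  also have "\<dots> \<le> card X + card Y + card Z"
    using card_Un_le[of "X \<union> Y" Z] card_Un_le[of X Y] by linarith
  also have "card X \<le> card L + card L"
    unfolding X_def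
    by (meson add_mono card_Un_le card_image_le L(2) order_trans)
  also have "card Y \<le> Suc m"
    unfolding Y_def using card_image_le[of "{..m}"] by simp
  also have "card Z \<le> k * n"
  proof -
    have "card Z \<le> card (S \<times> L)" unfolding Z_def using L \<open>finite S\<close> by (intro card_image_le) auto
    also have "\<dots> \<le> k * n" using L P by (simp add: card_cartesian_product)
    finally show ?thesis .
  qed
  \<comment> \<open>The sum is at most \<open>2 * n + (m + 1) + k * n\<close>, and
    \<open>m + 1 \<le> 2 * n\<close> because \<open>3 \<le> m \<le> n\<close>.\<close>
  finally show ?thesis using L(3) m unfolding m_def by linarith
qed

section \<open>Lower bound\<close>

text \<open>For positive \<open>c\<close> and \<open>t\<close> in (0, \<pi>), this is where the ray
  from the origin with polar angle \<open>t\<close> meets the line at height \<open>c\<close>.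
  Angles at the origin become differences of parameters.\<close>

definition level_point :: "real \<Rightarrow> real \<Rightarrow> real^2" where
  "level_point c t = vector [c * cot t, c]"

lemma level_point_alt:
  assumes "sin t \<noteq> 0"
  shows "level_point c t = (c / sin t) *\<^sub>R vector [cos t, sin t]"
  using assms by (simp add: level_point_def vec_eq_iff forall_2 cot_def)

lemma angle_at_level_points:
  assumes "0 < c" "s \<in> {0<..<pi}" "t \<in> {0<..<pi}"
  shows "angle_at (level_point c s) 0 (level_point c t) = \<bar>s - t\<bar>"
proof -
  have "sgn (level_point c x) = vector [cos x, sin x]" if "x \<in> {0<..<pi}" for x
  proof -
    have "0 < sin x" using that by (simp add: sin_gt_zero)
    then show ?thesis
      using assms(1) by (simp add: level_point_alt sgn_div_norm norm_cos_sin)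
  qed
  then have "angle_at (level_point c s) 0 (level_point c t) = arccos (cos (s - t))"
    using assms by (simp add: angle_at_sgn inner_vec_def sum_2 cos_diff)
  also have "cos (s - t) = cos \<bar>s - t\<bar>" by simp
  also have "arccos (cos \<bar>s - t\<bar>) = \<bar>s - t\<bar>"
    using assms by (intro arccos_cos) auto
  finally show ?thesis .
qed

lemma inj_on_level_point:
  assumes "0 < c"
  shows "inj_on (level_point c) {0<..<pi}"
proof (rule inj_onI)
  fix s t assume st: "s \<in> {0<..<pi}" "t \<in> {0<..<pi}" "level_point c s = level_point c t"
  \<comment> \<open>Equal points make the same angle at the origin with
    \<open>level_point c t\<close>.\<close>
  then have "\<bar>s - t\<bar> = \<bar>t - t\<bar>" using angle_at_level_points[OF assms] by metis
  then show "s = t" by simp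
qed

section \<open>A polygon with a vertex at the origin and its projection\<close>

lemma affine_hull_horizontal:
  assumes "0 < s"
  shows "affine hull {vector [s, c], vector [- s, c]} = {x :: real^2. x $ 2 = c}"
proof (intro equalityI subsetI)
  fix x :: "real^2" assume "x \<in> {x. x $ 2 = c}"
  then have "x = vector [s, c] + ((s - x $ 1) / (2 * s)) *\<^sub>R (vector [- s, c] - vector [s, c])"
    using assms by (simp add: vec_eq_iff forall_2 field_simps)
  then show "x \<in> affine hull {vector [s, c], vector [- s, c]}"
    by (auto simp: affine_hull_2_alt)
qed (auto simp: affine_hull_2_alt)

text \<open>The regular polygon with centre \<open>(0, 1)\<close>, circumradius \<open>1\<close> and \<open>p = 0\<close>: the vertex \<open>j\<close> lies in
  direction \<open>j \<pi> / m\<close> from \<open>p\<close>.\<close>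

lemma projected_polygon_config_level:
  assumes m: "3 \<le> m"
  obtains c where "0 < c"
    "projected_polygon_config m {x. x $ 2 = c}
       (insert 0 ((\<lambda>j. level_point c (pi * real j / real m)) ` {1..<m}))"
proof -
  define \<phi> where "\<phi> j = pi * real j / real m" for j :: nat
  \<comment> \<open>The circle in question has the polar equation r = 2 sin \<phi>; the double-angle
    formulas turn this into the form with centre \<open>z\<close>.\<close>
  define v :: "nat \<Rightarrow> real^2" where "v j = (2 * sin (\<phi> j)) *\<^sub>R vector [cos (\<phi> j), sin (\<phi> j)]" for j
  define z :: "real^2" where "z = vector [0, 1]"
  define V where "V = v ` {..<m}"
  have \<phi>: "\<phi> j \<in> {0<..<pi}" if "j \<in> {1..<m}" for j
    using that m by (auto simp: \<phi>_def field_simps)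
  have sin_pos: "0 < sin (\<phi> j)" if "j \<in> {1..<m}" for j
    using \<phi>[OF that] by (simp add: sin_gt_zero)
  have v_alt: "v j = vector [sin (2 * \<phi> j), 1 - cos (2 * \<phi> j)]" for j
    by (simp add: v_def vec_eq_iff forall_2 sin_double cos_double_sin power2_eq_square)
  have "v j = z + 1 *\<^sub>R vector [cos (- (pi / 2) + 2 * pi * real j / real m),
                            sin (- (pi / 2) + 2 * pi * real j / real m)]" for j
    by (simp add: v_alt z_def \<phi>_def vec_eq_iff forall_2 cos_diff sin_diff mult.assoc)
  then have poly: "regular_polygon m z V"
    unfolding regular_polygon_def V_def using m
    by (intro conjI exI[of _ 1] exI[of _ "- (pi/2)"]) auto
  have v0: "v 0 = 0" by (simp add: v_def \<phi>_def)
  have vnz: "v j \<noteq> 0" if "j \<in> {1..<m}" for j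
    using sin_pos[OF that] by (auto simp: v_def vec_eq_iff forall_2)
  have "{..<m} = insert 0 {1..<m}" using m by auto
  then have V0: "0 \<in> V" "V - {0} = v ` {1..<m}" using v0 vnz by (auto simp: V_def)
  have line: "\<exists>c>0. projection_line m z V 0 {x. x $ 2 = c}"
  proof (cases "even m")
    case True
    \<comment> \<open>The vertex opposite to the origin has direction \<pi>/2, so every horizontal
      line is perpendicular to the diameter; the one through the centre is taken.\<close>
    define h where "h = m div 2"
    have h: "h \<in> {1..<m}" "\<phi> h = pi / 2" using True m by (auto simp: \<phi>_def h_def real_of_nat_div)
    have vh: "v h = vector [0, 2]" by (simp add: v_def h(2) vec_eq_iff forall_2)
    have "is_line {x :: real^2. x $ 2 = 1}"
      using affine_hull_horizontal[of 1 1, symmetric]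
      by (simp add: is_line_def aff_dim_affine_hull aff_dim_2 vec_eq_iff forall_2)
    moreover have "midpoint 0 (v h) = z"
      by (simp add: vh z_def midpoint_def vec_eq_iff forall_2)
    moreover have "\<forall>x\<in>{x. x $ 2 = 1}. \<forall>y\<in>{x. x $ 2 = 1}. orthogonal (x - y) (v h - 0)"
      by (simp add: vh orthogonal_def inner_vec_def sum_2)
    moreover have "v h \<in> V" using h by (auto simp: V_def)
    ultimately have "projection_line m z V 0 {x. x $ 2 = 1}"
      using True by (auto simp: projection_line_def)
    then show ?thesis by (intro exI[of _ 1]) auto
  next
    case False
    define c where "c = 1 - cos (2 * \<phi> 1)"
    have "2 * pi / real m < pi" using m by (simp add: field_simps)
    then have s: "0 < sin (2 * \<phi> 1)" using m by (intro sin_gt_zero) (auto simp: \<phi>_def)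
    \<comment> \<open>The two neighbours of the origin are mirror images in the vertical axis, hence
      span a horizontal line.\<close>
    have "2 * \<phi> (m - 1) = 2 * pi - 2 * \<phi> 1"
      using m by (simp add: \<phi>_def of_nat_diff field_simps)
    then have u: "v 1 = vector [sin (2 * \<phi> 1), c]" and w: "v (m - 1) = vector [- sin (2 * \<phi> 1), c]"
      by (simp_all only: v_alt c_def sin_2pi_minus cos_2pi_minus)
    have c: "0 < c" using sin_pos[of 1] m by (auto simp: c_def cos_double_sin)
    have norm_v: "norm (v j) = 2 * sin (\<phi> j)" if "j \<in> {1..<m}" for j
      using sin_pos[OF that] by (simp add: v_def norm_cos_sin)
    \<comment> \<open>Distances from the origin are 2 sin \<phi>, so the neighbours are nearest:
      sine increases up to \<pi>/2, and the other half follows by reflection.\<close>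
    have min: "sin (\<phi> 1) \<le> sin (\<phi> j)" if j: "j \<in> {1..<m}" for j
    proof -
      have 1: "sin (\<phi> 1) \<le> sin (\<phi> i)" if "1 \<le> i" "2 * i \<le> m" for i
      proof (rule sin_monotone_2pi_le)
        show "- (pi / 2) \<le> \<phi> 1" using \<phi>[of 1] m by auto
        show "\<phi> 1 \<le> \<phi> i" using that m by (simp add: \<phi>_def divide_right_mono)
        have "real (2 * i) \<le> real m" using that by (simp only: of_nat_le_iff)
        then show "\<phi> i \<le> pi / 2" using m by (simp add: \<phi>_def field_simps)
      qed
      have 2: "sin (\<phi> (m - j)) = sin (\<phi> j)"
      proof -
        have "\<phi> (m - j) = pi - \<phi> j" using j by (simp add: \<phi>_def of_nat_diff field_simps)
        then show ?thesis by simp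
      qed
      show ?thesis
      proof (cases "2 * j \<le> m")
        case True then show ?thesis using 1 j by auto
      next
        case False then show ?thesis using 1[of "m - j"] 2 j by auto
      qed
    qed
    have eq: "sin (\<phi> (m - 1)) = sin (\<phi> 1)"
    proof -
      have "\<phi> (m - 1) = pi - \<phi> 1" using m by (simp add: \<phi>_def of_nat_diff field_simps)
      then show ?thesis by simp
    qed
    have mem: "v 1 \<in> V - {0}" "v (m - 1) \<in> V - {0}" using V0 m by auto
    have "v 1 \<noteq> v (m - 1)" unfolding u w using s by (simp add: vec_eq_iff forall_2)
    moreover have "\<forall>x\<in>V - {0}. dist 0 (v 1) \<le> dist 0 x \<and> dist 0 (v (m - 1)) \<le> dist 0 x"
      unfolding V0(2) using m min eq by (auto simp: norm_v)
    moreover have "{x. x $ 2 = c} = affine hull {v 1, v (m - 1)}"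
      unfolding u w using affine_hull_horizontal[OF s] by simp
    ultimately have "projection_line m z V 0 {x. x $ 2 = c}"
      using False mem unfolding projection_line_def by auto
    then show ?thesis using c by blast
  qed
  then obtain c where c: "0 < c" "projection_line m z V 0 {x. x $ 2 = c}" by blast
  have proj: "affine hull {0, v j} \<inter> {x. x $ 2 = c} = {level_point c (\<phi> j)}"
    if j: "j \<in> {1..<m}" for j
  proof (intro equalityI subsetI)
    fix x assume "x \<in> affine hull {0, v j} \<inter> {x. x $ 2 = c}"
    then obtain t where "x = t *\<^sub>R v j" "x $ 2 = c" by (auto simp: affine_hull_2_alt simp del: scaleR_cancel_right)
    then show "x \<in> {level_point c (\<phi> j)}"
      using sin_pos[OF j] by (auto simp: level_point_def v_def vec_eq_iff forall_2 cot_def)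
  next
    fix x assume "x \<in> {level_point c (\<phi> j)}"
    \<comment> \<open>The factor is \<open>c\<close> divided by the height of \<open>v j\<close>,
      which is 2 sin^2 \<phi>.\<close>
    then have "x = 0 + (c / (2 * sin (\<phi> j) ^ 2)) *\<^sub>R (v j - 0)" "x $ 2 = c"
      using sin_pos[OF j]
      by (auto simp: level_point_def v_def vec_eq_iff forall_2 cot_def power2_eq_square)
    then show "x \<in> affine hull {0, v j} \<inter> {x. x $ 2 = c}"
      by (auto simp: affine_hull_2_alt)
  qed
  have "insert 0 ((\<lambda>j. level_point c (\<phi> j)) ` {1..<m}) =
      insert 0 (\<Union>r\<in>V - {0}. affine hull {0, r} \<inter> {x. x $ 2 = c})"
  proof -
    have "(\<Union>r\<in>V - {0}. affine hull {0, r} \<inter> {x. x $ 2 = c}) =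
        (\<Union>j\<in>{1..<m}. {level_point c (\<phi> j)})"
      unfolding V0(2) image_image by (intro SUP_cong refl proj)
    then show ?thesis by auto
  qed
  then have "projected_polygon_config m {x. x $ 2 = c}
      (insert 0 ((\<lambda>j. level_point c (\<phi> j)) ` {1..<m}))"
    unfolding projected_polygon_config_def using poly V0(1) c(2) by blast
  then show ?thesis using that[OF c(1)] by (simp add: \<phi>_def)
qed

text \<open>The \<open>k\<close> extra points are placed in the directions \<open>i / (k + 1) \<cdot> \<pi> / m\<close> for \<open>1 \<le> i \<le> k\<close>, so that
  their angles to the projected vertices are pairwise distinct.\<close>

lemma config_with_many_angles:
  assumes "k + 3 \<le> n"
  obtains P where "P \<in> configs n k" "k * (n - k - 1) \<le> num_angles P" "n - k - 2 \<le> num_angles P"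
proof -
  define m where "m = n - k"
  have m: "3 \<le> m" "n = m + k" using assms by (auto simp: m_def)
  obtain c where c: "0 < c" and Q': "projected_polygon_config m {x. x $ 2 = c}
       (insert 0 ((\<lambda>j. level_point c (pi * real j / real m)) ` {1..<m}))"
    using projected_polygon_config_level[OF m(1)] .
  \<comment> \<open>Directions are measured in units of \<pi>/m: projected vertices sit at the
    integers 1 to \<open>m - 1\<close>, extra points at fractions strictly between 0 and 1.\<close>
  define pt where "pt x = level_point c (pi * x / real m)" for x
  define \<epsilon> where "\<epsilon> i = real i / real (k + 1)" for i
  define Q where "Q = insert 0 ((\<lambda>j. pt (real j)) ` {1..<m})"
  define S where "S = (\<lambda>i. pt (\<epsilon> i)) ` {1..k}"
  have dir: "pi * x / real m \<in> {0<..<pi}" if "x \<in> {0<..<real m}" for x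
    using that by (auto simp: field_simps)
  have inj: "inj_on pt {0<..<real m}"
  proof (rule inj_onI)
    fix x y assume "x \<in> {0<..<real m}" "y \<in> {0<..<real m}" "pt x = pt y"
    then have "pi * x / real m = pi * y / real m"
      unfolding pt_def by (intro inj_onD[OF inj_on_level_point[OF c]] dir)
    then show "x = y" using m by simp
  qed
  have nz: "pt x \<noteq> 0" for x using c by (auto simp: pt_def level_point_def vec_eq_iff forall_2)
  have \<epsilon>: "\<epsilon> i \<in> {0<..<1}" if "i \<in> {1..k}" for i
    using that by (auto simp: \<epsilon>_def field_simps)
  have \<epsilon>m: "\<epsilon> i \<in> {0<..<real m}" if "i \<in> {1..k}" for i
    using \<epsilon>[OF that] m by auto
  have j: "real j \<in> {0<..<real m}" if "j \<in> {1..<m}" for j using that by auto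
  have "inj_on (\<lambda>j. pt (real j)) {1..<m}"
    using inj_onD[OF inj] j by (intro inj_onI) (metis of_nat_eq_iff)
  then have "card ((\<lambda>j. pt (real j)) ` {1..<m}) = m - 1" by (simp add: card_image)
  moreover have "0 \<notin> (\<lambda>j. pt (real j)) ` {1..<m}" using nz by (metis imageE)
  ultimately have cardQ: "finite Q" "card Q = m" using m by (auto simp: Q_def)
  have "inj_on (\<lambda>i. pt (\<epsilon> i)) {1..k}"
  proof (rule inj_onI)
    fix i i' assume "i \<in> {1..k}" "i' \<in> {1..k}" "pt (\<epsilon> i) = pt (\<epsilon> i')"
    then have "\<epsilon> i = \<epsilon> i'" using inj_onD[OF inj] \<epsilon>m by blast
    then show "i = i'" by (simp add: \<epsilon>_def)
  qed
  then have cardS: "finite S" "card S = k" by (auto simp: S_def card_image)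
  have disj: "Q \<inter> S = {}"
  proof -
    have "pt (real a) \<noteq> pt (\<epsilon> i)" if "a \<in> {1..<m}" "i \<in> {1..k}" for a i
    proof
      assume "pt (real a) = pt (\<epsilon> i)"
      then have "real a = \<epsilon> i" using inj_onD[OF inj] \<epsilon>m j that by blast
      moreover have "1 \<le> real a" using that(1) by simp
      ultimately show False using \<epsilon>[OF that(2)] by simp
    qed
    then show ?thesis using nz by (force simp: Q_def S_def)
  qed
  define P where "P = Q \<union> S"
  have "projected_polygon_config m {x. x $ 2 = c} Q" using Q' by (simp add: Q_def pt_def)
  moreover have "S \<subseteq> {x. x $ 2 = c}" by (auto simp: S_def pt_def level_point_def)
  moreover have "finite P" "card P = n"
    using cardQ cardS disj m by (auto simp: P_def card_Un_disjoint)
  ultimately have P: "P \<in> configs n k"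
    unfolding configs_def using cardQ cardS disj by (auto simp: P_def m_def)
  have ang: "pi * (y - x) / real m \<in> angle_set P"
    if "pt x \<in> P" "pt y \<in> P" "x \<in> {0<..<real m}" "y \<in> {0<..<real m}" "x < y" for x y
  proof -
    have "angle_at (pt x) 0 (pt y) = \<bar>pi * x / real m - pi * y / real m\<bar>"
      unfolding pt_def using that by (intro angle_at_level_points c dir)
    also have "pi * x / real m - pi * y / real m = - (pi * (y - x) / real m)"
      by (simp add: algebra_simps diff_divide_distrib)
    also have "\<bar>\<dots>\<bar> = pi * (y - x) / real m" using that by simp
    finally have eq: "angle_at (pt x) 0 (pt y) = pi * (y - x) / real m" .
    have "pi * (y - x) / real m \<in> {0<..<pi}" using that by (intro dir) auto
    moreover have "pt x \<noteq> pt y" using inj_onD[OF inj] that by blast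
    moreover have "0 \<in> P" by (simp add: P_def Q_def)
    moreover have "pt x \<noteq> 0" "0 \<noteq> pt y" using nz[of x] nz[of y] by auto
    ultimately show ?thesis
      unfolding angle_set_def eq[symmetric] using that by blast
  qed
  have fin: "finite (angle_set P)" using \<open>finite P\<close> by (rule finite_angle_set)
  \<comment> \<open>Angle between extra point \<open>i\<close> and projected vertex
    \<open>j\<close>. It is injective because two offsets in (0, 1) differ by less than 1, which
    forces equal integers and then equal offsets.\<close>
  define f where "f = (\<lambda>(i, j). pi * (real j - \<epsilon> i) / real m)"
  have "f ` ({1..k} \<times> {1..<m}) \<subseteq> angle_set P"
  proof safe
    fix i a assume ia: "i \<in> {1..k}" "a \<in> {1..<m}"
    show "f (i, a) \<in> angle_set P"
      unfolding f_def prod.case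
    proof (rule ang)
      show "pt (\<epsilon> i) \<in> P" "pt (real a) \<in> P" using ia by (auto simp: P_def Q_def S_def)
      have "1 \<le> real a" using ia by simp
      then show "\<epsilon> i < real a" using \<epsilon>[OF ia(1)] by simp
    qed (use \<epsilon>m j ia in blast)+
  qed
  moreover have "inj_on f ({1..k} \<times> {1..<m})"
  proof (rule inj_onI; clarify)
    fix i a i' a'
    assume *: "i \<in> {1..k}" "i' \<in> {1..k}" "f (i, a) = f (i', a')"
    then have "real a - \<epsilon> i = real a' - \<epsilon> i'" using m by (simp add: f_def)
    moreover from this have "a = a'" using \<epsilon>[OF *(1)] \<epsilon>[OF *(2)] by auto
    ultimately show "i = i' \<and> a = a'" by (simp add: \<epsilon>_def)
  qed
  ultimately have "card ({1..k} \<times> {1..<m}) \<le> num_angles P"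
    unfolding num_angles_def by (intro card_inj_on_le[OF _ _ fin])
  then have 1: "k * (n - k - 1) \<le> num_angles P" by (simp add: m_def)
  \<comment> \<open>Angles between the first projected vertex and the later ones. These
    \<open>m - 2\<close> values supply the linear lower bound when \<open>k = 0\<close>.\<close>
  define g where "g = (\<lambda>j. pi * (real (Suc j) - real 1) / real m)"
  have "g ` {1..<m - 1} \<subseteq> angle_set P"
  proof safe
    fix a assume a: "a \<in> {1..<m - 1}"
    show "g a \<in> angle_set P"
      unfolding g_def
    proof (rule ang)
      have "1 \<in> {1..<m}" "Suc a \<in> {1..<m}" using a m by auto
      then show "pt (real 1) \<in> P" "pt (real (Suc a)) \<in> P" by (auto simp only: P_def Q_def)
    qed (use a m in auto)
  qed
  moreover have "inj_on g {1..<m - 1}" using m by (intro inj_onI) (simp add: g_def)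
  ultimately have "card {1..<m - 1} \<le> num_angles P"
    unfolding num_angles_def by (intro card_inj_on_le[OF _ _ fin])
  then have 2: "n - k - 2 \<le> num_angles P" by (simp add: m_def)
  show ?thesis using that P 1 2 by blast
qed

section \<open>From single configurations to the maximum\<close>

text \<open>The configuration with many angles serves twice: it bounds the maximum from below, and
  it shows that \<open>configs n k\<close> is nonempty, so that \<open>Max\<close> can be bounded
  from above.\<close>

lemma max_angles_bounds:
  assumes "k + 3 \<le> n"
  shows "max_angles n k \<le> 4 * n + k * n" "k * (n - k - 1) \<le> max_angles n k"
    "n - k - 2 \<le> max_angles n k"
proof -
  obtain P where P: "P \<in> configs n k" "k * (n - k - 1) \<le> num_angles P" "n - k - 2 \<le> num_angles P"
    using config_with_many_angles[OF assms] .
  have "num_angles P \<le> max_angles n k"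
    unfolding max_angles_def using P(1) by (intro Max_ge finite_num_angles_configs) auto
  then show "k * (n - k - 1) \<le> max_angles n k" "n - k - 2 \<le> max_angles n k" using P by auto
  show "max_angles n k \<le> 4 * n + k * n"
    unfolding max_angles_def using P(1) num_angles_config_le
    by (intro Max.boundedI finite_num_angles_configs) auto
qed

text \<open>At \<open>k = 0\<close> the product vanishes while linearly many angles remain, so that
  case is stated with order \<open>n\<close>. The middle conjunct makes the constants independent of
  \<open>k\<close>; only the threshold for \<open>n\<close> depends on it.\<close>

theorem proposition3p4:
  "(\<forall>k\<ge>1. (\<lambda>n. real (max_angles n k)) \<in> \<Theta>(\<lambda>n. real n * real k)) \<and>
   (\<exists>c>0::real. \<exists>C>0::real. \<forall>k\<ge>1. \<forall>\<^sub>F n in sequentially.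
      c * (real n * real k) \<le> real (max_angles n k) \<and>
      real (max_angles n k) \<le> C * (real n * real k)) \<and>
   (\<lambda>n. real (max_angles n 0)) \<in> \<Theta>(\<lambda>n. real n)"
proof -
  have pos: "1/2 * (real n * real k) \<le> real (max_angles n k) \<and>
      real (max_angles n k) \<le> 5 * (real n * real k)" if "1 \<le> k" "2 * k + 3 \<le> n" for n k
  proof
    \<comment> \<open>Beyond \<open>2 * k + 2\<close> the factor \<open>n - k - 1\<close> is at
      least half of \<open>n\<close>.\<close>
    have "n * k \<le> k * (2 * (n - k - 1))" using that by (simp add: mult.commute)
    also have "\<dots> \<le> 2 * max_angles n k" using max_angles_bounds(2)[of k n] that by simp
    finally have "real (n * k) \<le> real (2 * max_angles n k)" by (simp only: of_nat_le_iff)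
    then show "1/2 * (real n * real k) \<le> real (max_angles n k)" by simp
    have "max_angles n k \<le> 4 * n + k * n" using that by (intro max_angles_bounds) auto
    \<comment> \<open>Since \<open>k \<ge> 1\<close>, the linear term is absorbed into the
      product.\<close>
    also have "\<dots> \<le> 5 * (n * k)" using that by simp
    finally have "real (max_angles n k) \<le> real (5 * (n * k))" by (simp only: of_nat_le_iff)
    then show "real (max_angles n k) \<le> 5 * (real n * real k)" by simp
  qed
  have ev: "\<forall>\<^sub>F n in sequentially. 1/2 * (real n * real k) \<le> real (max_angles n k) \<and>
      real (max_angles n k) \<le> 5 * (real n * real k)" if "1 \<le> k" for k
    using eventually_ge_at_top[of "2 * k + 3"] by eventually_elim (use pos that in blast)
  have ev0: "\<forall>\<^sub>F n in sequentially. 1/3 * real n \<le> real (max_angles n 0) \<and>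
      real (max_angles n 0) \<le> 4 * real n"
    using eventually_ge_at_top[of 3]
  proof eventually_elim
    case (elim n)
    \<comment> \<open>From \<open>n \<ge> 3\<close> follows \<open>n \<le> 3 * (n - 2)\<close>, with
      equality at 3, whence the constant 1/3.\<close>
    then have "n \<le> 3 * max_angles n 0" "max_angles n 0 \<le> 4 * n"
      using max_angles_bounds(1,3)[of 0 n] by auto
    then show ?case by linarith
  qed
  have "(\<lambda>n. real (max_angles n k)) \<in> \<Theta>(\<lambda>n. real n * real k)" if "1 \<le> k" for k
    using ev[OF that]
    by (intro bigthetaI' [of "1/2" 5]) (auto elim!: eventually_mono)
  moreover have "(\<lambda>n. real (max_angles n 0)) \<in> \<Theta>(\<lambda>n. real n)"
    using ev0 by (intro bigthetaI' [of "1/3" 4]) (auto elim!: eventually_mono)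
  moreover have "\<exists>c>0::real. \<exists>C>0::real. \<forall>k\<ge>1. \<forall>\<^sub>F n in sequentially.
      c * (real n * real k) \<le> real (max_angles n k) \<and>
      real (max_angles n k) \<le> C * (real n * real k)"
    using ev by (intro exI[of _ "1/2"] exI[of _ 5] conjI allI impI) auto
  ultimately show ?thesis by blast
qed

end
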